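(* Let $1\leq k\leq n-3$ and let $G$ be a connected graph with $n$ vertices and $k$ pendent vertices. If $G$ has the maximum value of $SO_{1}$ among all connected graphs with $n$ vertices and $k$ pendent vertices, then $\Delta(G)=n-1$, $\Delta_{2}(G)=n-k-1$, and the vertex of degree $n-1$ is unique.
   Context: All graphs are finite and simple. For a graph $G$, $d_u$ is the degree of the vertex $u$, and $SO_{1}(G)=\frac{1}{2}\sum_{uv\in E(G)}|d_{u}^{2}-d_{v}^{2}|$. A pendent vertex is a vertex of degree $1$. $\Delta(G)$ is the maximum degree and $\Delta_{2}(G)$ the second maximum degree of $G$, i.e. the second term of the degree sequence of $G$ arranged in nonincreasing order. *)

theory Defs
  imports Complex_Main "HOL-Library.Multiset" "Graph_Theory.Graph_Theory"
begin

text \<open>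
  A finite simple graph is a \<^locale>\<open>pair_graph\<close>: every edge \<open>uv\<close> is represented by the two
  arcs \<open>(u, v)\<close> and \<open>(v, u)\<close>. Out-degree and in-degree then agree and both count the neighbours.
\<close>

definition vdegree :: "'a pair_pre_digraph \<Rightarrow> 'a \<Rightarrow> nat" where
  "vdegree G u = out_degree (with_proj G) u"

definition edges :: "'a pair_pre_digraph \<Rightarrow> 'a set set" where
  "edges G = {{u, v} | u v. (u, v) \<in> parcs G}"

text \<open>
  The value \<open>\<bar>d\<^sub>u\<^sup>2 - d\<^sub>v\<^sup>2\<bar>\<close> for \<open>e = {u, v}\<close>; it does not depend on the order of \<open>u\<close> and \<open>v\<close>
  (see \<open>edge_weight_doubleton\<close>).
\<close>

definition edge_weight :: "'a pair_pre_digraph \<Rightarrow> 'a set \<Rightarrow> real" where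
  "edge_weight G e =
     (THE r. \<exists>u v. e = {u, v} \<and> r = \<bar>(real (vdegree G u))\<^sup>2 - (real (vdegree G v))\<^sup>2\<bar>)"

lemma edge_weight_doubleton:
  "edge_weight G {u, v} = \<bar>(real (vdegree G u))\<^sup>2 - (real (vdegree G v))\<^sup>2\<bar>"
  unfolding edge_weight_def
  by (rule the_equality) (auto simp: doubleton_eq_iff abs_minus_commute)

text \<open>Each undirected edge contributes once, not once per arc.\<close>

definition SO1 :: "'a pair_pre_digraph \<Rightarrow> real" where
  "SO1 G = 1 / 2 * (\<Sum>e\<in>edges G. edge_weight G e)"

definition pendent :: "'a pair_pre_digraph \<Rightarrow> 'a set" where
  "pendent G = {v \<in> pverts G. vdegree G v = 1}"

definition max_degree :: "'a pair_pre_digraph \<Rightarrow> nat" where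
  "max_degree G = Max (vdegree G ` pverts G)"

definition degree_sequence :: "'a pair_pre_digraph \<Rightarrow> nat list" where
  "degree_sequence G =
     rev (sorted_list_of_multiset (image_mset (vdegree G) (mset_set (pverts G))))"

text \<open>
  The second term of the sequence, counted with multiplicity: it equals the maximum degree
  if at least two vertices attain the latter. List indices start at 0.
\<close>

definition second_max_degree :: "'a pair_pre_digraph \<Rightarrow> nat" where
  "second_max_degree G = degree_sequence G ! 1"

definition connected_graphs :: "nat \<Rightarrow> nat \<Rightarrow> 'a pair_pre_digraph set" where
  "connected_graphs n k =
     {G. pair_graph G \<and> connected (with_proj G) \<and> card (pverts G) = n \<and> card (pendent G) = k}"

end

theory Submission
  imports Defs
begin

text \<open>
  Let \<open>v\<close> be a vertex of maximum degree in an extremal graph. Joining \<open>v\<close> to a non-adjacent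
  non-pendent vertex increases \<open>SO\<^sub>1\<close> and creates or destroys no pendent vertex, so \<open>v\<close> is adjacent
  to all non-pendent vertices. If a pendent vertex \<open>w\<close> hangs at \<open>u \<noteq> v\<close>, then moving \<open>w\<close> from \<open>u\<close> to
  \<open>v\<close> increases \<open>SO\<^sub>1\<close>; when \<open>d\<^sub>u = 2\<close>, the vertex \<open>u\<close> would become pendent, which is repaired by
  joining \<open>u\<close> to a further non-pendent vertex. Hence \<open>d\<^sub>v = n - 1\<close>, and \<open>v\<close> is the only such vertex
  because it has a pendent neighbour.

  Let \<open>x\<close> have the second largest degree and let \<open>y\<close> be a non-pendent vertex not adjacent to \<open>x\<close>.
  Adding \<open>xy\<close> increases \<open>SO\<^sub>1\<close> strictly if \<open>d\<^sub>x \<ge> 3\<close>. If \<open>d\<^sub>x = 2\<close>, the non-pendent vertices other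
  than \<open>v\<close> span a perfect matching and adding \<open>xy\<close> does not change \<open>SO\<^sub>1\<close>; the new graph is again
  extremal, now with \<open>d\<^sub>x = 3\<close>, and \<open>x\<close> is not adjacent to the partner of \<open>y\<close>, a contradiction.
\<close>

subsection \<open>Arc sums under addition and deletion of an edge\<close>

definition deg :: "'a rel \<Rightarrow> 'a \<Rightarrow> nat" where
  "deg A u = card (A `` {u})"

text \<open>The weight and the arc set are separate arguments, so that old and new degrees can be
  compared on one and the same set of arcs.\<close>

definition arc_sum :: "('a \<Rightarrow> 'a \<Rightarrow> real) \<Rightarrow> 'a rel \<Rightarrow> real" where
  "arc_sum f A = (\<Sum>(a, b)\<in>A. f a b)"

definition sqdiff :: "('a \<Rightarrow> nat) \<Rightarrow> 'a \<Rightarrow> 'a \<Rightarrow> real" where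
  "sqdiff d a b = \<bar>(real (d a))\<^sup>2 - (real (d b))\<^sup>2\<bar>"

text \<open>Each edge is counted as two arcs and there is no factor 1/2, so this is four times
  \<open>SO1\<close>.\<close>

definition irregularity :: "'a rel \<Rightarrow> real" where
  "irregularity A = arc_sum (sqdiff (deg A)) A"

definition add_edge :: "'a \<Rightarrow> 'a \<Rightarrow> 'a rel \<Rightarrow> 'a rel" where
  "add_edge x y A = insert (x, y) (insert (y, x) A)"

definition del_edge :: "'a \<Rightarrow> 'a \<Rightarrow> 'a rel \<Rightarrow> 'a rel" where
  "del_edge x y A = A - {(x, y), (y, x)}"

lemma sqdiff_commute: "sqdiff d a b = sqdiff d b a"
  by (simp add: sqdiff_def abs_minus_commute)

lemma finite_add_edge [simp]: "finite (add_edge x y A) \<longleftrightarrow> finite A"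
  by (simp add: add_edge_def)

lemma finite_del_edge [simp]: "finite (del_edge x y A) \<longleftrightarrow> finite A"
  by (simp add: del_edge_def)

lemma sym_add_edge: "sym A \<Longrightarrow> sym (add_edge x y A)"
  by (auto simp: sym_def add_edge_def)

lemma sym_del_edge: "sym A \<Longrightarrow> sym (del_edge x y A)"
  by (auto simp: sym_def del_edge_def)

lemma irrefl_add_edge: "irrefl A \<Longrightarrow> x \<noteq> y \<Longrightarrow> irrefl (add_edge x y A)"
  by (auto simp: irrefl_def add_edge_def)

lemma irrefl_del_edge: "irrefl A \<Longrightarrow> irrefl (del_edge x y A)"
  by (auto simp: irrefl_def del_edge_def)

lemma add_del_edge: "sym A \<Longrightarrow> (x, y) \<in> A \<Longrightarrow> add_edge x y (del_edge x y A) = A"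
  by (auto simp: add_edge_def del_edge_def dest: symD)

lemma deg_add_edge:
  assumes "finite A" "sym A" "(x, y) \<notin> A" "x \<noteq> y"
  shows "deg (add_edge x y A) = (deg A)(x := Suc (deg A x), y := Suc (deg A y))"
proof
  fix z
  have nyx: "(y, x) \<notin> A" using assms(2,3) by (auto dest: symD)
  have fin: "finite (A `` {z})" for z using assms(1) by (simp add: finite_Image)
  have "add_edge x y A `` {x} = insert y (A `` {x})" "add_edge x y A `` {y} = insert x (A `` {y})"
    using assms(4) by (auto simp: add_edge_def)
  moreover have "add_edge x y A `` {z} = A `` {z}" if "z \<noteq> x" "z \<noteq> y"
    using that by (auto simp: add_edge_def)
  ultimately show "deg (add_edge x y A) z = ((deg A)(x := Suc (deg A x), y := Suc (deg A y))) z"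
    using assms nyx fin by (auto simp: deg_def)
qed

lemma deg_del_edge:
  assumes "finite A" "sym A" "(x, y) \<in> A" "x \<noteq> y"
  shows "deg (del_edge x y A) = (deg A)(x := deg A x - 1, y := deg A y - 1)"
proof -
  have "deg A = deg (add_edge x y (del_edge x y A))"
    using assms by (simp add: add_del_edge)
  also have "\<dots> = (deg (del_edge x y A))
    (x := Suc (deg (del_edge x y A) x), y := Suc (deg (del_edge x y A) y))"
    using assms by (intro deg_add_edge) (auto simp: sym_del_edge, auto simp: del_edge_def)
  finally show ?thesis by (auto simp: fun_eq_iff assms)
qed

text \<open>The vertex \<open>w\<close> trades one neighbour for another, so its degree does not
  change; positivity of \<open>deg A w\<close> keeps the truncated subtraction exact.\<close>

lemma deg_move_edge:
  assumes "finite A" "sym A" "(w, u) \<in> A" "(w, v) \<notin> A" and neq: "w \<noteq> u" "w \<noteq> v"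
  shows "deg (add_edge w v (del_edge w u A)) = (deg A)(u := deg A u - 1, v := Suc (deg A v))"
proof -
  have "u \<noteq> v" using assms by auto
  have "u \<in> A `` {w}" "finite (A `` {w})" using assms by (auto simp: finite_Image)
  then have "0 < deg A w" by (auto simp: deg_def card_gt_0_iff)
  moreover have "deg (add_edge w v (del_edge w u A)) = (deg (del_edge w u A))
    (w := Suc (deg (del_edge w u A) w), v := Suc (deg (del_edge w u A) v))"
    using assms by (intro deg_add_edge) (auto simp: sym_del_edge, auto simp: del_edge_def)
  ultimately show ?thesis
    using deg_del_edge[OF assms(1-3) neq(1)] neq \<open>u \<noteq> v\<close> by (auto simp: fun_eq_iff)
qed

text \<open>The edge to \<open>x\<close> returns to \<open>u\<close> the degree lost with
  \<open>w\<close>, so only \<open>v\<close> and \<open>x\<close> gain. This is the repair for the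
  case that \<open>u\<close> would become a leaf.\<close>

lemma deg_move_edge_add_edge:
  assumes "finite A" "sym A" "(w, u) \<in> A" "(w, v) \<notin> A" and neq: "w \<noteq> u" "w \<noteq> v"
    and "u \<noteq> x" "(u, x) \<notin> A" "x \<noteq> w" "x \<noteq> v"
  shows "deg (add_edge u x (add_edge w v (del_edge w u A)))
    = (deg A)(v := Suc (deg A v), x := Suc (deg A x))"
proof -
  let ?A1 = "add_edge w v (del_edge w u A)"
  have "u \<noteq> v" using assms by auto
  have "w \<in> A `` {u}" "finite (A `` {u})" using assms by (auto simp: finite_Image dest: symD)
  then have "0 < deg A u" by (auto simp: deg_def card_gt_0_iff)
  moreover have "deg (add_edge u x ?A1) = (deg ?A1)(u := Suc (deg ?A1 u), x := Suc (deg ?A1 x))"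
    using assms
    by (intro deg_add_edge) (auto simp: sym_del_edge sym_add_edge, auto simp: del_edge_def add_edge_def)
  ultimately show ?thesis
    using deg_move_edge[OF assms(1-6)] assms(7,9,10) \<open>u \<noteq> v\<close> by (auto simp: fun_eq_iff)
qed

section \<open>Weighted sums over arcs\<close>

lemma arc_sum_add_edge:
  assumes "finite A" "sym A" "(x, y) \<notin> A" "x \<noteq> y" "f x y = f y x"
  shows "arc_sum f (add_edge x y A) = arc_sum f A + 2 * f x y"
proof -
  have "(y, x) \<notin> A" using assms(2,3) by (auto dest: symD)
  then show ?thesis using assms by (simp add: arc_sum_def add_edge_def)
qed

lemma arc_sum_sqdiff_add_edge:
  assumes "finite A" "sym A" "(x, y) \<notin> A" "x \<noteq> y"
  shows "arc_sum (sqdiff d) (add_edge x y A) = arc_sum (sqdiff d) A + 2 * sqdiff d x y"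
  using assms by (intro arc_sum_add_edge sqdiff_commute)

text \<open>
  Distributing a lower bound over the endpoints: \<open>\<alpha>\<close> for every arc end at \<open>p\<close> and \<open>\<beta>\<close> for every
  arc end at \<open>q\<close>.
\<close>

lemma arc_sum_ge:
  fixes \<alpha> \<beta> :: real
  assumes "finite B" "sym B" "p \<noteq> q"
    and comm: "\<And>a b. c a b = c b a"
    and p: "\<And>b. (p, b) \<in> B \<Longrightarrow> b \<noteq> q \<Longrightarrow> \<alpha> \<le> c p b"
    and q: "\<And>b. (q, b) \<in> B \<Longrightarrow> b \<noteq> p \<Longrightarrow> \<beta> \<le> c q b"
    and pq: "(p, q) \<in> B \<Longrightarrow> \<alpha> + \<beta> \<le> c p q"
    and other: "\<And>a b. (a, b) \<in> B \<Longrightarrow> a \<noteq> p \<Longrightarrow> a \<noteq> q \<Longrightarrow> b \<noteq> p \<Longrightarrow> b \<noteq> q \<Longrightarrow> 0 \<le> c a b"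
    and irr: "irrefl B"
  shows "2 * (\<alpha> * deg B p + \<beta> * deg B q) \<le> arc_sum c B"
proof -
  \<comment> \<open>A vertex potential: the hypotheses say that \<open>\<phi> a + \<phi> b\<close>
    bounds the weight of every arc from below, and its total only depends on the degrees of
    \<open>p\<close> and \<open>q\<close>.\<close>
  define \<phi> where "\<phi> z = (if z = p then \<alpha> else if z = q then \<beta> else 0)" for z
  have fib: "(\<Sum>e\<in>B. if fst e = r then x else 0) = x * real (deg B r)" for r and x :: real
  proof -
    have "bij_betw (\<lambda>b. (r, b)) (B `` {r}) {e \<in> B. fst e = r}"
      by (rule bij_betwI[of _ _ _ snd]) auto
    then have "card {e \<in> B. fst e = r} = deg B r"
      by (simp add: deg_def bij_betw_same_card)
    then show ?thesis using assms(1) by (simp flip: sum.inter_filter)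
  qed
  have fst_sum: "(\<Sum>e\<in>B. \<phi> (fst e)) = \<alpha> * deg B p + \<beta> * deg B q"
  proof -
    have "(\<Sum>e\<in>B. \<phi> (fst e)) =
      (\<Sum>e\<in>B. (if fst e = p then \<alpha> else 0) + (if fst e = q then \<beta> else 0))"
      using \<open>p \<noteq> q\<close> by (intro sum.cong) (auto simp: \<phi>_def)
    then show ?thesis by (simp only: sum.distrib fib)
  qed
  \<comment> \<open>Reversal of arcs maps the symmetric relation \<open>B\<close> onto itself,
    whence the factor 2.\<close>
  have "(\<Sum>e\<in>B. \<phi> (snd e)) = (\<Sum>e\<in>B. \<phi> (fst e))"
    by (rule sum.reindex_bij_witness[of _ prod.swap prod.swap])
      (use \<open>sym B\<close> in \<open>auto dest: symD\<close>)
  with fst_sum have "2 * (\<alpha> * deg B p + \<beta> * deg B q) = (\<Sum>e\<in>B. \<phi> (fst e) + \<phi> (snd e))"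
    by (simp add: sum.distrib)
  also have "\<dots> \<le> (\<Sum>e\<in>B. case e of (a, b) \<Rightarrow> c a b)"
  proof (rule sum_mono)
    fix e assume "e \<in> B"
    obtain a b where e: "e = (a, b)" by fastforce
    with \<open>e \<in> B\<close> have ab: "(a, b) \<in> B" "(b, a) \<in> B" using \<open>sym B\<close> by (auto dest: symD)
    have "a \<noteq> b" using ab irr by (auto simp: irrefl_def)
    then have "\<phi> a + \<phi> b \<le> c a b"
      using ab p[of a] p[of b] q[of a] q[of b] pq other[of a b] comm[of a b] \<open>p \<noteq> q\<close>
      unfolding \<phi>_def by (auto split: if_splits)
    then show "\<phi> (fst e) + \<phi> (snd e) \<le> (case e of (a, b) \<Rightarrow> c a b)" by (simp add: e)
  qed
  finally show ?thesis by (simp add: arc_sum_def)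
qed

lemma arc_sum_diff: "arc_sum (\<lambda>a b. f a b - g a b) A = arc_sum f A - arc_sum g A"
  by (simp add: arc_sum_def case_prod_unfold sum_subtractf)

section \<open>Change of a difference of squares when one degree changes by one\<close>

lemma incr_upper:
  fixes a b :: real
  assumes "0 \<le> b" "b \<le> a"
  shows "\<bar>(a + 1)\<^sup>2 - b\<^sup>2\<bar> - \<bar>a\<^sup>2 - b\<^sup>2\<bar> = 2 * a + 1"
proof -
  have "b\<^sup>2 \<le> a\<^sup>2" "b\<^sup>2 \<le> (a + 1)\<^sup>2" using assms by (auto intro!: power_mono)
  then show ?thesis by (simp add: power2_eq_square algebra_simps)
qed

text \<open>Triangle inequality: the square changes by \<open>2 * a + 1\<close>, which bounds the
  loss when nothing is known about the other endpoint. Here \<open>b\<close> stands for the square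
  of its degree.\<close>

lemma incr_any:
  fixes a b :: real
  assumes "0 \<le> a"
  shows "- (2 * a + 1) \<le> \<bar>(a + 1)\<^sup>2 - b\<bar> - \<bar>a\<^sup>2 - b\<bar>"
proof -
  have "(a + 1)\<^sup>2 = a\<^sup>2 + (2 * a + 1)" by (simp add: power2_eq_square algebra_simps)
  then show ?thesis using assms by linarith
qed

lemma decr_any:
  fixes a b :: real
  assumes "1 \<le> a"
  shows "- (2 * a - 1) \<le> \<bar>(a - 1)\<^sup>2 - b\<bar> - \<bar>a\<^sup>2 - b\<bar>"
proof -
  have "(a - 1)\<^sup>2 = a\<^sup>2 - (2 * a - 1)" by (simp add: power2_eq_square algebra_simps)
  then show ?thesis using assms by linarith
qed


subsection \<open>Moves that increase the irregularity\<close>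

text \<open>Every edge at \<open>x\<close> gains, and these gains cover all possible losses at
  \<open>y\<close>, whose degree is no larger. Strictness comes from the new edge if the degrees
  differ, and from the gain at \<open>x\<close> if they agree.\<close>

lemma irregularity_add_edge_max:
  assumes fin: "finite A" and "sym A" "irrefl A" and "x \<noteq> y" "(x, y) \<notin> A"
    and max: "\<And>z. deg A z \<le> deg A x" and pos: "0 < deg A x"
  shows "irregularity A < irregularity (add_edge x y A)"
proof -
  let ?A' = "add_edge x y A"
  define a b where "a = real (deg A x)" and "b = real (deg A y)"
  have ab: "0 \<le> b" "b \<le> a" "0 < a" using max[of y] pos by (auto simp: a_def b_def)
  \<comment> \<open>If \<open>y\<close> has maximum degree too, the edges at \<open>y\<close> also
    gain; otherwise the worst case is assumed.\<close>
  define \<beta> where "\<beta> = (if deg A y = deg A x then 2 * b + 1 else - (2 * b + 1))"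
  have d': "deg ?A' = (deg A)(x := Suc (deg A x), y := Suc (deg A y))"
    by (rule deg_add_edge) fact+
  have "2 * ((2 * a + 1) * deg A x + \<beta> * deg A y)
      \<le> arc_sum (\<lambda>u v. sqdiff (deg ?A') u v - sqdiff (deg A) u v) A"
  proof (rule arc_sum_ge[OF fin \<open>sym A\<close> \<open>x \<noteq> y\<close>])
    fix z assume "(x, z) \<in> A" "z \<noteq> y"
    then have "z \<noteq> x" using \<open>irrefl A\<close> by (auto simp: irrefl_def)
    then show "2 * a + 1 \<le> sqdiff (deg ?A') x z - sqdiff (deg A) x z"
      using \<open>x \<noteq> y\<close> \<open>z \<noteq> y\<close> incr_upper[of "deg A z" a] max[of z]
      by (simp add: sqdiff_def d' a_def add.commute)
  next
    fix z assume "(y, z) \<in> A" "z \<noteq> x"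
    then have "z \<noteq> y" using \<open>irrefl A\<close> by (auto simp: irrefl_def)
    then show "\<beta> \<le> sqdiff (deg ?A') y z - sqdiff (deg A) y z"
      using \<open>x \<noteq> y\<close> \<open>z \<noteq> x\<close> incr_upper[of "deg A z" b] max[of z] incr_any[of b "(deg A z)\<^sup>2"]
      by (auto simp: sqdiff_def d' b_def \<beta>_def add.commute)
  qed (use assms in \<open>auto simp: sqdiff_commute d' sqdiff_def\<close>)
  then have *: "2 * ((2 * a + 1) * a + \<beta> * b) \<le> arc_sum (sqdiff (deg ?A')) A - irregularity A"
    by (simp add: arc_sum_diff irregularity_def a_def b_def)
  have "sqdiff (deg ?A') x y = \<bar>(a + 1)\<^sup>2 - (b + 1)\<^sup>2\<bar>"
    using \<open>x \<noteq> y\<close> by (simp add: sqdiff_def d' a_def b_def add.commute)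
  with arc_sum_sqdiff_add_edge[OF fin assms(2,5,4), of "deg ?A'"]
  have **: "irregularity ?A' = arc_sum (sqdiff (deg ?A')) A + 2 * \<bar>(a + 1)\<^sup>2 - (b + 1)\<^sup>2\<bar>"
    by (simp add: irregularity_def)
  have "0 < (2 * a + 1) * a + \<beta> * b + \<bar>(a + 1)\<^sup>2 - (b + 1)\<^sup>2\<bar>"
  proof (cases "deg A y = deg A x")
    case True
    have "0 < (2 * a + 1) * a" "0 \<le> \<beta> * b" using ab True by (auto simp: \<beta>_def)
    then show ?thesis by linarith
  next
    case False
    then have "b < a" using max[of y] by (simp add: a_def b_def)
    then have "(b + 1)\<^sup>2 < (a + 1)\<^sup>2" "(2 * b + 1) * b \<le> (2 * a + 1) * a"
      using ab by (auto intro!: power_strict_mono mult_mono)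
    moreover have "\<beta> * b = - ((2 * b + 1) * b)" using False by (simp add: \<beta>_def algebra_simps)
    ultimately show ?thesis by linarith
  qed
  with * ** show ?thesis by argo
qed

text \<open>Gains at \<open>v\<close> outweigh losses at \<open>u\<close>, and the moved edge, whose
  end \<open>w\<close> keeps degree 1, gets a strictly larger weight because its other end now has
  degree \<open>deg A v + 1\<close>.\<close>

lemma irregularity_move_edge_max:
  assumes fin: "finite A" and "sym A" "irrefl A" and uv: "u \<noteq> v" and wu: "(w, u) \<in> A"
    and wv: "w \<noteq> v" "(w, v) \<notin> A" and w1: "deg A w = 1"
    and max: "\<And>z. deg A z \<le> deg A v"
  shows "irregularity A < irregularity (add_edge w v (del_edge w u A))"
proof -
  \<comment> \<open>The common part of the old and the new graph. The degrees compared on it are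
    those of the full graphs; its own degrees only count the arcs.\<close>
  define B where "B = del_edge w u A"
  let ?A' = "add_edge w v B"
  have neq: "w \<noteq> u" using wu \<open>irrefl A\<close> by (auto simp: irrefl_def)
  have B: "finite B" "sym B" "irrefl B" "(w, u) \<notin> B" "(w, v) \<notin> B" "B \<subseteq> A"
    using fin \<open>sym A\<close> \<open>irrefl A\<close> wv
    by (auto simp: B_def sym_del_edge irrefl_del_edge) (auto simp: del_edge_def)
  have A: "A = add_edge w u B" using \<open>sym A\<close> wu by (simp add: B_def add_del_edge)
  define a b where "a = real (deg A v)" and "b = real (deg A u)"
  have dB: "deg B = (deg A)(w := 0, u := deg A u - 1)"
    unfolding B_def using deg_del_edge[OF fin \<open>sym A\<close> wu neq] w1 by simp
  have "deg A u = Suc (deg B u)"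
    unfolding A using B neq by (subst deg_add_edge) auto
  then have ab: "1 \<le> b" "b \<le> a" "deg B u = b - 1" "deg B v = a"
    using max[of u] uv wv by (auto simp: a_def b_def dB)
  have d': "deg ?A' = (deg A)(u := deg A u - 1, v := Suc (deg A v))"
    unfolding B_def by (rule deg_move_edge) fact+
  have "2 * ((2 * a + 1) * deg B v + (- (2 * b - 1)) * deg B u)
      \<le> arc_sum (\<lambda>u v. sqdiff (deg ?A') u v - sqdiff (deg A) u v) B"
  proof (rule arc_sum_ge[OF B(1,2)])
    fix z assume "(v, z) \<in> B" "z \<noteq> u"
    then have "z \<noteq> v" using \<open>irrefl B\<close> by (auto simp: irrefl_def)
    then show "2 * a + 1 \<le> sqdiff (deg ?A') v z - sqdiff (deg A) v z"
      using \<open>u \<noteq> v\<close> \<open>z \<noteq> u\<close> incr_upper[of "deg A z" a] max[of z]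
      by (simp add: sqdiff_def d' a_def add.commute)
  next
    fix z assume "(u, z) \<in> B" "z \<noteq> v"
    then have "z \<noteq> u" using \<open>irrefl B\<close> by (auto simp: irrefl_def)
    then show "- (2 * b - 1) \<le> sqdiff (deg ?A') u z - sqdiff (deg A) u z"
      using \<open>u \<noteq> v\<close> \<open>z \<noteq> v\<close> decr_any[of b "(deg A z)\<^sup>2"] ab(1)
      by (auto simp: sqdiff_def d' b_def of_nat_diff)
  next
    \<comment> \<open>An edge \<open>uv\<close> is affected at both ends, and both changes widen the
      gap, so it gains even \<open>(2 * a + 1) + (2 * b - 1)\<close>.\<close>
    have "b\<^sup>2 \<le> a\<^sup>2" "(b - 1)\<^sup>2 \<le> b\<^sup>2" "a\<^sup>2 \<le> (a + 1)\<^sup>2"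
      using ab by (auto intro!: power_mono)
    moreover have "sqdiff (deg ?A') v u = \<bar>(a + 1)\<^sup>2 - (b - 1)\<^sup>2\<bar>" "sqdiff (deg A) v u = \<bar>a\<^sup>2 - b\<^sup>2\<bar>"
      using uv ab(1) by (auto simp: sqdiff_def d' a_def b_def of_nat_diff add.commute)
    ultimately have "sqdiff (deg ?A') v u - sqdiff (deg A) v u
        = ((a + 1)\<^sup>2 - a\<^sup>2) + (b\<^sup>2 - (b - 1)\<^sup>2)" by simp
    also have "\<dots> = (2 * a + 1) + (2 * b - 1)" by (simp add: power2_eq_square algebra_simps)
    finally show "2 * a + 1 + - (2 * b - 1) \<le> sqdiff (deg ?A') v u - sqdiff (deg A) v u"
      using ab by simp
  qed (use uv B in \<open>auto simp: sqdiff_commute d' sqdiff_def\<close>)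
  then have *: "2 * ((2 * a + 1) * a - (2 * b - 1) * (b - 1))
      \<le> arc_sum (sqdiff (deg ?A')) B - arc_sum (sqdiff (deg A)) B"
    by (simp add: arc_sum_diff ab(3,4) algebra_simps)
  have "irregularity ?A' = arc_sum (sqdiff (deg ?A')) B + 2 * \<bar>1\<^sup>2 - (a + 1)\<^sup>2\<bar>"
    using arc_sum_sqdiff_add_edge[OF B(1,2,5) wv(1), of "deg ?A'"] neq wv w1
    by (simp add: irregularity_def sqdiff_def d' a_def add.commute)
  moreover have "arc_sum (sqdiff (deg A)) (add_edge w u B)
      = arc_sum (sqdiff (deg A)) B + 2 * \<bar>1\<^sup>2 - b\<^sup>2\<bar>"
    using arc_sum_sqdiff_add_edge[OF B(1,2,4) neq, of "deg A"] w1
    by (simp add: sqdiff_def b_def)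
  then have "irregularity A = arc_sum (sqdiff (deg A)) B + 2 * \<bar>1\<^sup>2 - b\<^sup>2\<bar>"
    by (simp add: irregularity_def flip: A)
  moreover have "(2 * b - 1) * (b - 1) \<le> (2 * a + 1) * a"
    using ab by (intro mult_mono) auto
  then have "arc_sum (sqdiff (deg A)) B \<le> arc_sum (sqdiff (deg ?A')) B" using * by argo
  moreover have "1\<^sup>2 \<le> b\<^sup>2" "b\<^sup>2 < (a + 1)\<^sup>2"
    using ab by (auto intro!: power_mono power_strict_mono)
  ultimately have "irregularity A < irregularity ?A'" by simp
  then show ?thesis by (simp add: B_def)
qed

text \<open>Only \<open>v\<close> and \<open>x\<close> change their degrees. The gains at
  \<open>v\<close> cover the losses at \<open>x\<close>, and the new edge \<open>wv\<close> weighs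
  more than the deleted edge \<open>wu\<close>.\<close>

lemma irregularity_move_edge_add_edge:
  assumes fin: "finite A" and "sym A" "irrefl A" and wu: "(w, u) \<in> A"
    and wv: "w \<noteq> v" "(w, v) \<notin> A" and ux: "u \<noteq> x" "(u, x) \<notin> A"
    and neqs: "u \<noteq> v" "x \<noteq> v" "x \<noteq> w"
    and w1: "deg A w = 1" and u2: "deg A u = 2" and x2: "2 \<le> deg A x"
    and max: "\<And>z. deg A z \<le> deg A v"
  shows "irregularity A < irregularity (add_edge u x (add_edge w v (del_edge w u A)))"
proof -
  define B where "B = del_edge w u A"
  let ?A1 = "add_edge w v B"
  let ?A' = "add_edge u x ?A1"
  have neq: "w \<noteq> u" using wu \<open>irrefl A\<close> by (auto simp: irrefl_def)
  have B: "finite B" "sym B" "irrefl B" "(w, u) \<notin> B" "(w, v) \<notin> B" "B \<subseteq> A"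
    using fin \<open>sym A\<close> \<open>irrefl A\<close> wv
    by (auto simp: B_def sym_del_edge irrefl_del_edge) (auto simp: del_edge_def)
  have A1: "finite ?A1" "sym ?A1" "(u, x) \<notin> ?A1"
    using B ux neq neqs by (auto simp: sym_add_edge) (auto simp: add_edge_def)
  have A: "A = add_edge w u B" using \<open>sym A\<close> wu by (simp add: B_def add_del_edge)
  define a b where "a = real (deg A v)" and "b = real (deg A x)"
  have dB: "deg B = (deg A)(w := 0, u := 1)"
    unfolding B_def using deg_del_edge[OF fin \<open>sym A\<close> wu neq] w1 u2 by simp
  have ab: "2 \<le> b" "b \<le> a" "deg B x = b" "deg B v = a"
    using max[of x] x2 neqs wv ux by (auto simp: a_def b_def dB)
  have d': "deg ?A' = (deg A)(v := Suc (deg A v), x := Suc (deg A x))"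
    unfolding B_def by (rule deg_move_edge_add_edge) fact+
  have "2 * ((2 * a + 1) * deg B v + (- (2 * b + 1)) * deg B x)
      \<le> arc_sum (\<lambda>u v. sqdiff (deg ?A') u v - sqdiff (deg A) u v) B"
  proof (rule arc_sum_ge[OF B(1,2)])
    fix z assume "(v, z) \<in> B" "z \<noteq> x"
    then have "z \<noteq> v" using \<open>irrefl B\<close> by (auto simp: irrefl_def)
    then show "2 * a + 1 \<le> sqdiff (deg ?A') v z - sqdiff (deg A) v z"
      using \<open>x \<noteq> v\<close> \<open>z \<noteq> x\<close> incr_upper[of "deg A z" a] max[of z]
      by (simp add: sqdiff_def d' a_def add.commute)
  next
    fix z assume "(x, z) \<in> B" "z \<noteq> v"
    then have "z \<noteq> x" using \<open>irrefl B\<close> by (auto simp: irrefl_def)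
    then show "- (2 * b + 1) \<le> sqdiff (deg ?A') x z - sqdiff (deg A) x z"
      using \<open>x \<noteq> v\<close> \<open>z \<noteq> v\<close> incr_any[of b "(deg A z)\<^sup>2"]
      by (auto simp: sqdiff_def d' b_def add.commute)
  next
    have "b\<^sup>2 \<le> a\<^sup>2" "(b + 1)\<^sup>2 \<le> (a + 1)\<^sup>2"
      using ab by (auto intro!: power_mono)
    moreover have "sqdiff (deg ?A') v x = \<bar>(a + 1)\<^sup>2 - (b + 1)\<^sup>2\<bar>" "sqdiff (deg A) v x = \<bar>a\<^sup>2 - b\<^sup>2\<bar>"
      using neqs by (auto simp: sqdiff_def d' a_def b_def add.commute)
    ultimately have "sqdiff (deg ?A') v x - sqdiff (deg A) v x
        = ((a + 1)\<^sup>2 - a\<^sup>2) - ((b + 1)\<^sup>2 - b\<^sup>2)" by simp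
    also have "\<dots> = (2 * a + 1) - (2 * b + 1)" by (simp add: power2_eq_square algebra_simps)
    finally show "2 * a + 1 + - (2 * b + 1) \<le> sqdiff (deg ?A') v x - sqdiff (deg A) v x"
      by simp
  qed (use neqs B in \<open>auto simp: sqdiff_commute d' sqdiff_def\<close>)
  then have *: "2 * ((2 * a + 1) * a - (2 * b + 1) * b)
      \<le> arc_sum (sqdiff (deg ?A')) B - arc_sum (sqdiff (deg A)) B"
    by (simp add: arc_sum_diff ab(3,4) algebra_simps)
  have "irregularity ?A' = arc_sum (sqdiff (deg ?A')) ?A1 + 2 * \<bar>2\<^sup>2 - (b + 1)\<^sup>2\<bar>"
    using arc_sum_sqdiff_add_edge[OF A1 ux(1), of "deg ?A'"] neqs ux u2
    by (simp add: irregularity_def sqdiff_def d' b_def add.commute)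
  also have "arc_sum (sqdiff (deg ?A')) ?A1 = arc_sum (sqdiff (deg ?A')) B + 2 * \<bar>1\<^sup>2 - (a + 1)\<^sup>2\<bar>"
    using arc_sum_sqdiff_add_edge[OF B(1,2,5) wv(1), of "deg ?A'"] neqs wv w1
    by (simp add: sqdiff_def d' a_def add.commute)
  finally have "irregularity ?A' = arc_sum (sqdiff (deg ?A')) B
      + 2 * \<bar>1\<^sup>2 - (a + 1)\<^sup>2\<bar> + 2 * \<bar>2\<^sup>2 - (b + 1)\<^sup>2\<bar>" .
  \<comment> \<open>The deleted edge joins degrees 1 and 2: its two arcs weigh 3 each.\<close>
  moreover have "arc_sum (sqdiff (deg A)) (add_edge w u B) = arc_sum (sqdiff (deg A)) B + 6"
    using arc_sum_sqdiff_add_edge[OF B(1,2,4) neq, of "deg A"] w1 u2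
    by (simp add: sqdiff_def)
  then have "irregularity A = arc_sum (sqdiff (deg A)) B + 6"
    by (simp add: irregularity_def flip: A)
  moreover have "(2 * b + 1) * b \<le> (2 * a + 1) * a"
    using ab by (intro mult_mono) auto
  then have "arc_sum (sqdiff (deg A)) B \<le> arc_sum (sqdiff (deg ?A')) B" using * by argo
  \<comment> \<open>As \<open>a \<ge> 2\<close>, an arc of the new edge \<open>wv\<close> weighs at
    least 8, against 3 for an arc of \<open>wu\<close>.\<close>
  moreover have "9 \<le> (a + 1)\<^sup>2" using power_mono[of 3 "a + 1" 2] ab by simp
  then have "\<bar>1\<^sup>2 - (a + 1)\<^sup>2\<bar> = (a + 1)\<^sup>2 - 1" by simp
  moreover have "0 \<le> \<bar>2\<^sup>2 - (b + 1)\<^sup>2\<bar>" by simp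
  ultimately have "irregularity A < irregularity ?A'" using \<open>9 \<le> (a + 1)\<^sup>2\<close> by argo
  then show ?thesis by (simp add: B_def)
qed

text \<open>Away from \<open>v\<close>, the vertex \<open>x\<close> has maximum degree and the
  previous kind of estimate applies; the edges \<open>vx\<close> and \<open>vy\<close> lose weight
  and have to be accounted for separately.\<close>

lemma irregularity_add_edge_second:
  assumes fin: "finite A" and "sym A" "irrefl A" and neqs: "x \<noteq> y" "v \<noteq> x" "v \<noteq> y"
    and xy: "(x, y) \<notin> A" and vx: "(v, x) \<in> A" and vy: "(v, y) \<in> A"
    and max: "\<And>z. z \<noteq> v \<Longrightarrow> deg A z \<le> deg A x" and xv: "deg A x < deg A v"
    and x2: "2 \<le> deg A x"
  shows "irregularity A \<le> irregularity (add_edge x y A)"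
    and "3 \<le> deg A x \<Longrightarrow> irregularity A < irregularity (add_edge x y A)"
proof -
  let ?A' = "add_edge x y A"
  \<comment> \<open>Both edges to \<open>v\<close> are removed, so that on \<open>B\<close> all
    neighbours of \<open>x\<close> and \<open>y\<close> have degree at most
    \<open>deg A x\<close>.\<close>
  define C where "C = del_edge v x A"
  define B where "B = del_edge v y C"
  have C: "finite C" "sym C" "irrefl C" "(v, x) \<notin> C" "(v, y) \<in> C"
    using assms by (auto simp: C_def sym_del_edge irrefl_del_edge) (auto simp: del_edge_def)
  have B: "finite B" "sym B" "irrefl B" "(v, y) \<notin> B" "(v, x) \<notin> B" "(x, y) \<notin> B"
    using C xy by (auto simp: B_def sym_del_edge irrefl_del_edge) (auto simp: del_edge_def C_def)
  have vxB: "(x, v) \<notin> B" "(y, v) \<notin> B" using B by (auto dest: symD)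
  have AC: "A = add_edge v x C" and CB: "C = add_edge v y B"
    using assms C by (simp_all add: C_def B_def add_del_edge)
  define a b where "a = real (deg A x)" and "b = real (deg A y)"
  have dA: "deg A = (deg B)(v := deg B v + 2, x := Suc (deg B x), y := Suc (deg B y))"
    using deg_add_edge[OF C(1,2,4) neqs(2)] deg_add_edge[OF B(1,2,4) neqs(3)] neqs
    by (auto simp: fun_eq_iff simp flip: AC CB)
  have dBx: "deg B x = a - 1" "deg B y = b - 1" "1 \<le> b"
    using neqs by (auto simp: dA a_def b_def)
  have ab: "b \<le> a" "2 \<le> a" using max[of y] neqs x2 by (auto simp: a_def b_def)
  define \<beta> where "\<beta> = (if deg A y = deg A x then 2 * b + 1 else - (2 * b + 1))"
  have d': "deg ?A' = (deg A)(x := Suc (deg A x), y := Suc (deg A y))"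
    by (rule deg_add_edge) fact+
  have "2 * ((2 * a + 1) * deg B x + \<beta> * deg B y)
      \<le> arc_sum (\<lambda>u v. sqdiff (deg ?A') u v - sqdiff (deg A) u v) B"
  proof (rule arc_sum_ge[OF B(1,2) \<open>x \<noteq> y\<close>])
    fix z assume "(x, z) \<in> B" "z \<noteq> y"
    then have "z \<noteq> x" "z \<noteq> v" using \<open>irrefl B\<close> vxB by (auto simp: irrefl_def)
    then show "2 * a + 1 \<le> sqdiff (deg ?A') x z - sqdiff (deg A) x z"
      using \<open>x \<noteq> y\<close> \<open>z \<noteq> y\<close> incr_upper[of "deg A z" a] max[of z]
      by (simp add: sqdiff_def d' a_def add.commute)
  next
    fix z assume "(y, z) \<in> B" "z \<noteq> x"
    then have "z \<noteq> y" "z \<noteq> v" using \<open>irrefl B\<close> vxB by (auto simp: irrefl_def)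
    then show "\<beta> \<le> sqdiff (deg ?A') y z - sqdiff (deg A) y z"
      using \<open>x \<noteq> y\<close> \<open>z \<noteq> x\<close> incr_upper[of "deg A z" b] max[of z] incr_any[of b "(deg A z)\<^sup>2"]
      by (auto simp: sqdiff_def d' b_def \<beta>_def add.commute)
  qed (use B in \<open>auto simp: sqdiff_commute d' sqdiff_def\<close>)
  then have *: "2 * ((2 * a + 1) * (a - 1) + \<beta> * (b - 1))
      \<le> arc_sum (sqdiff (deg ?A')) B - arc_sum (sqdiff (deg A)) B"
    by (simp add: arc_sum_diff dBx)
  have split: "arc_sum (sqdiff d) A
      = arc_sum (sqdiff d) B + 2 * sqdiff d v x + 2 * sqdiff d v y" for d
    using arc_sum_sqdiff_add_edge[OF C(1,2,4) neqs(2), of d]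
      arc_sum_sqdiff_add_edge[OF B(1,2,4) neqs(3), of d]
    by (simp flip: AC CB)
  have drop: "sqdiff (deg ?A') v z = sqdiff (deg A) v z - (2 * real (deg A z) + 1)"
    if "z = x \<or> z = y" for z
  proof -
    have "real (deg A z) + 1 \<le> deg A v" using that xv max[of y] neqs by auto
    then have "(real (deg A z) + 1)\<^sup>2 \<le> (real (deg A v))\<^sup>2" "(real (deg A z))\<^sup>2 \<le> (real (deg A v))\<^sup>2"
      by (auto intro!: power_mono)
    then show ?thesis
      using that neqs by (auto simp: sqdiff_def d' power2_eq_square algebra_simps)
  qed
  have "(b + 1)\<^sup>2 \<le> (a + 1)\<^sup>2" using ab dBx by (intro power_mono) auto
  then have "sqdiff (deg ?A') x y = (a + 1)\<^sup>2 - (b + 1)\<^sup>2"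
    using \<open>x \<noteq> y\<close> by (simp add: sqdiff_def d' a_def b_def add.commute)
  then have "irregularity ?A' = arc_sum (sqdiff (deg ?A')) A + 2 * ((a + 1)\<^sup>2 - (b + 1)\<^sup>2)"
    using arc_sum_sqdiff_add_edge[OF fin assms(2) xy neqs(1), of "deg ?A'"]
    by (simp add: irregularity_def)
  then have **: "irregularity A + 2 * ((2 * a + 1) * (a - 1) + \<beta> * (b - 1)
      - (2 * a + 1) - (2 * b + 1) + (a + 1)\<^sup>2 - (b + 1)\<^sup>2) \<le> irregularity ?A'"
    using * drop by (simp add: irregularity_def split a_def b_def)
  let ?g = "(2 * a + 1) * (a - 1) + \<beta> * (b - 1) - (2 * a + 1) - (2 * b + 1) + (a + 1)\<^sup>2 - (b + 1)\<^sup>2"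
  \<comment> \<open>Half of the guaranteed change: the gains at \<open>x\<close> and
    \<open>y\<close> inside \<open>B\<close>, the losses on \<open>vx\<close> and \<open>vy\<close>,
    and the new edge \<open>xy\<close>.\<close>
  have g: "0 \<le> ?g \<and> (3 \<le> deg A x \<longrightarrow> 0 < ?g)"
  proof (cases "deg A y = deg A x")
    case True
    \<comment> \<open>This vanishes for \<open>a = 2\<close>, which is why the first claim is not
      strict.\<close>
    then have "?g = 2 * ((2 * a + 1) * (a - 2))"
      by (simp add: \<beta>_def a_def b_def algebra_simps)
    then show ?thesis using ab by (auto simp: a_def)
  next
    case False
    then have "deg A y < deg A x" using max[of y] neqs by auto
    then have "b + 1 \<le> a" by (simp add: a_def b_def)
    \<comment> \<open>Inserting \<open>b + 1 \<le> a\<close> into both factors leaves a deficit of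
      3, which the difference of squares, at least \<open>2 * b + 3\<close>, more than
      covers.\<close>
    then have m: "(2 * (b + 1) + 1) * (b - 1) \<le> (2 * a + 1) * (a - 2)"
      using dBx by (intro mult_mono) auto
    have "0 < (a + 1)\<^sup>2 - (b + 1)\<^sup>2" using \<open>b + 1 \<le> a\<close> dBx
      by (simp add: power_strict_mono)
    moreover have "(a + 1)\<^sup>2 \<ge> (b + 2)\<^sup>2" using \<open>b + 1 \<le> a\<close> dBx by (intro power_mono) auto
    moreover have "(b + 2)\<^sup>2 - (b + 1)\<^sup>2 = 2 * b + 3" by (simp add: power2_eq_square algebra_simps)
    moreover have "?g = (2 * a + 1) * (a - 2) - (2 * b + 1) * b + (a + 1)\<^sup>2 - (b + 1)\<^sup>2"
      using False by (simp add: \<beta>_def algebra_simps)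
    moreover have "(2 * (b + 1) + 1) * (b - 1) = (2 * b + 1) * b - 3" by (simp add: algebra_simps)
    ultimately show ?thesis using m dBx by linarith
  qed
  show "irregularity A \<le> irregularity ?A'" using ** g by argo
  show "irregularity A < irregularity ?A'" if "3 \<le> deg A x" using ** g that by argo
qed


subsection \<open>Extremal graphs\<close>

definition conn_graph :: "'a set \<Rightarrow> 'a rel \<Rightarrow> bool" where
  "conn_graph V A \<longleftrightarrow> finite V \<and> V \<noteq> {} \<and> A \<subseteq> V \<times> V \<and> sym A \<and> irrefl A \<and>
    (\<forall>u\<in>V. \<forall>v\<in>V. (u, v) \<in> A\<^sup>*)"

definition leaves :: "'a set \<Rightarrow> 'a rel \<Rightarrow> 'a set" where
  "leaves V A = {v \<in> V. deg A v = 1}"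

lemma conn_graph_finite: "conn_graph V A \<Longrightarrow> finite A"
  unfolding conn_graph_def by (meson finite_SigmaI finite_subset)

lemma conn_graph_add_edge:
  assumes "conn_graph V A" "x \<in> V" "y \<in> V" "x \<noteq> y"
  shows "conn_graph V (add_edge x y A)"
proof -
  have "A\<^sup>* \<subseteq> (add_edge x y A)\<^sup>*" by (intro rtrancl_mono) (auto simp: add_edge_def)
  then show ?thesis
    using assms by (auto simp: conn_graph_def sym_add_edge irrefl_add_edge) (auto simp: add_edge_def)
qed

text \<open>Every vertex lies within distance 2 of \<open>v\<close>, and by symmetry walks to
  \<open>v\<close> can be reversed and joined.\<close>

lemma conn_graph_hubI:
  assumes "finite V" "v \<in> V" "A \<subseteq> V \<times> V" "sym A" "irrefl A"
    and hub: "\<And>z. z \<in> V \<Longrightarrow> z = v \<or> (z, v) \<in> A \<or> (\<exists>y. (z, y) \<in> A \<and> (y, v) \<in> A)"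
  shows "conn_graph V A"
proof -
  have to_v: "(z, v) \<in> A\<^sup>*" if "z \<in> V" for z
    using hub[OF that] by (auto intro: converse_rtrancl_into_rtrancl)
  have "sym (A\<^sup>*)" using \<open>sym A\<close> by (rule sym_rtrancl)
  then have "(u, z) \<in> A\<^sup>*" if "u \<in> V" "z \<in> V" for u z
    using to_v[OF that(1)] to_v[OF that(2)] by (meson rtrancl_trans symD)
  then show ?thesis using assms by (auto simp: conn_graph_def)
qed

lemma conn_graph_deg_pos:
  assumes "conn_graph V A" "z \<in> V" "2 \<le> card V"
  shows "0 < deg A z"
proof -
  have "\<not> V \<subseteq> {z}" using card_mono[of "{z}" V] assms(3) by auto
  then obtain y where "y \<in> V" "y \<noteq> z" by blast
  then have "(z, y) \<in> A\<^sup>*" using assms by (auto simp: conn_graph_def)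
  then obtain a where "(z, a) \<in> A" using \<open>y \<noteq> z\<close> by (metis converse_rtranclE)
  moreover have "finite (A `` {z})" using conn_graph_finite[OF assms(1)] by (simp add: finite_Image)
  ultimately show ?thesis by (auto simp: deg_def card_gt_0_iff)
qed

lemma Image_singleton_of_deg_1:
  assumes "deg A p = 1" "(p, q) \<in> A"
  shows "A `` {p} = {q}"
proof -
  obtain r where "A `` {p} = {r}" using assms(1) unfolding deg_def by (rule card_1_singletonE)
  then show ?thesis using assms(2) by auto
qed

text \<open>Two adjacent leaves would form a whole component, hence a graph with only two
  vertices.\<close>

lemma leaf_neighbour_deg:
  assumes "conn_graph V A" "(p, q) \<in> A" "deg A p = 1" "3 \<le> card V"
  shows "deg A q \<noteq> 1"
proof
  assume q: "deg A q = 1"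
  have "(q, p) \<in> A" using assms by (auto simp: conn_graph_def dest: symD)
  then have im: "A `` {p} = {q}" "A `` {q} = {p}"
    using Image_singleton_of_deg_1 assms q by metis+
  have V: "p \<in> V" using assms by (auto simp: conn_graph_def)
  have "z \<in> {p, q}" if "(p, z) \<in> A\<^sup>*" for z
    using that by (induction rule: rtrancl_induct) (use im in auto)
  then have "V \<subseteq> {p, q}" using V assms(1) unfolding conn_graph_def by blast
  then have "card V \<le> card {p, q}" by (intro card_mono) auto
  also have "\<dots> \<le> 2" by (simp add: card_insert_if)
  finally show False using assms by simp
qed

text \<open>The competitors have the same vertex set, since every move changes edges only.\<close>

locale extremal_graph =
  fixes V :: "'a set" and A :: "'a rel" and k :: nat
  assumes graph: "conn_graph V A"
    and card_leaves: "card (leaves V A) = k"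
    and card_V: "k + 3 \<le> card V"
    and extremal: "\<And>A'. conn_graph V A' \<Longrightarrow> card (leaves V A') = k \<Longrightarrow>
      irregularity A' \<le> irregularity A"
begin

lemma fin_V: "finite V" and A_sub: "A \<subseteq> V \<times> V" and sym_A: "sym A" and irrefl_A: "irrefl A"
  using graph by (auto simp: conn_graph_def)

lemma fin_A: "finite A"
  using graph by (rule conn_graph_finite)

lemma fin_nbrs: "finite (A `` {z})"
  using fin_A by (simp add: finite_Image)

lemma arc_sym: "(a, b) \<in> A \<Longrightarrow> (b, a) \<in> A"
  using sym_A by (rule symD)

lemma deg_outside: "z \<notin> V \<Longrightarrow> deg A z = 0"
proof -
  assume "z \<notin> V"
  then have "A `` {z} = {}" using A_sub by auto
  then show ?thesis by (simp add: deg_def)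
qed

lemma deg_ge_2: "z \<in> V \<Longrightarrow> deg A z \<noteq> 1 \<Longrightarrow> 2 \<le> deg A z"
  using conn_graph_deg_pos[OF graph, of z] card_V by force

lemma card_inner: "3 \<le> card (V - leaves V A)"
proof -
  have "leaves V A \<subseteq> V" by (auto simp: leaves_def)
  then show ?thesis using card_V card_leaves fin_V by (simp add: card_Diff_subset finite_subset)
qed

text \<open>At least three vertices are non-pendent, so one remains besides any two given
  ones.\<close>

lemma inner_avoiding:
  obtains x where "x \<in> V" "deg A x \<noteq> 1" "x \<noteq> a" "x \<noteq> b"
proof -
  have "\<not> V - leaves V A \<subseteq> {a, b}"
  proof
    assume "V - leaves V A \<subseteq> {a, b}"
    then have "card (V - leaves V A) \<le> card {a, b}" by (intro card_mono) auto
    also have "\<dots> \<le> 2" by (simp add: card_insert_if)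
    finally show False using card_inner by simp
  qed
  then show thesis using that by (auto simp: leaves_def)
qed

text \<open>The form in which extremality is used: a move that keeps the set of leaves cannot
  increase the irregularity.\<close>

lemma not_improvable:
  assumes "conn_graph V A'" "\<And>z. z \<in> V \<Longrightarrow> deg A' z = 1 \<longleftrightarrow> deg A z = 1"
  shows "irregularity A' \<le> irregularity A"
proof -
  have "leaves V A' = leaves V A" using assms(2) by (auto simp: leaves_def)
  then show ?thesis using extremal[OF assms(1)] card_leaves by simp
qed

section \<open>Neighbours of a vertex of maximum degree\<close>

context
  fixes v
  assumes v: "v \<in> V" and max: "\<And>z. z \<in> V \<Longrightarrow> deg A z \<le> deg A v"
begin

lemma deg_le_max: "deg A z \<le> deg A v"
  using max deg_outside by (cases "z \<in> V") auto

lemma deg_max_ge_2: "2 \<le> deg A v"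
proof -
  obtain x where "x \<in> V" "deg A x \<noteq> 1" using inner_avoiding by metis
  then show ?thesis using deg_ge_2[of x] max[of x] by simp
qed

lemma max_adj_inner:
  assumes "z \<in> V" "z \<noteq> v" "deg A z \<noteq> 1"
  shows "(v, z) \<in> A"
proof (rule ccontr)
  assume nadj: "(v, z) \<notin> A"
  have "irregularity A < irregularity (add_edge v z A)"
    using assms deg_max_ge_2
    by (intro irregularity_add_edge_max fin_A sym_A irrefl_A nadj deg_le_max) auto
  moreover have "irregularity (add_edge v z A) \<le> irregularity A"
  proof (rule not_improvable)
    show "conn_graph V (add_edge v z A)"
      using assms v graph by (intro conn_graph_add_edge) auto
    show "deg (add_edge v z A) y = 1 \<longleftrightarrow> deg A y = 1" for y
      using deg_add_edge[OF fin_A sym_A nadj] assms deg_max_ge_2 deg_ge_2[of z] by auto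
  qed
  ultimately show False by simp
qed

text \<open>The edges from \<open>v\<close> to the non-pendent vertices survive, and every leaf
  other than \<open>w\<close> hangs at a non-pendent vertex, so \<open>v\<close> is a hub of the new
  graph.\<close>

lemma conn_graph_move_leaf:
  assumes w: "(w, u) \<in> A" "deg A w = 1" "w \<noteq> v" and "u \<noteq> v"
  shows "conn_graph V (add_edge w v (del_edge w u A))"
proof (rule conn_graph_hubI)
  let ?A' = "add_edge w v (del_edge w u A)"
  have wV: "w \<in> V" using w A_sub by auto
  show "?A' \<subseteq> V \<times> V" using A_sub v wV by (auto simp: add_edge_def del_edge_def)
  show "sym ?A'" by (intro sym_add_edge sym_del_edge sym_A)
  show "irrefl ?A'" using w irrefl_A by (intro irrefl_add_edge irrefl_del_edge) auto
  have u: "deg A u \<noteq> 1" using leaf_neighbour_deg[OF graph w(1,2)] card_V by simp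
  have inner: "(z, v) \<in> ?A'" if "z \<in> V" "z \<noteq> v" "deg A z \<noteq> 1" for z
    using max_adj_inner[OF that] w \<open>u \<noteq> v\<close>
    by (auto simp: add_edge_def del_edge_def dest: arc_sym)
  show "z = v \<or> (z, v) \<in> ?A' \<or> (\<exists>y. (z, y) \<in> ?A' \<and> (y, v) \<in> ?A')" if z: "z \<in> V" for z
  proof (cases "z = v \<or> z = w \<or> deg A z \<noteq> 1")
    case True
    then show ?thesis using inner z by (auto simp: add_edge_def)
  next
    case False
    then obtain y where y: "(z, y) \<in> A"
      by (auto simp: deg_def card_1_singleton_iff)
    have "deg A y \<noteq> 1" using leaf_neighbour_deg[OF graph y] False card_V by simp
    then have "(z, y) \<in> ?A'" using y False w u by (auto simp: add_edge_def del_edge_def)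
    moreover have "y \<in> V" using y A_sub by auto
    ultimately show ?thesis using inner \<open>deg A y \<noteq> 1\<close> by blast
  qed
qed (use fin_V v in auto)

lemma max_adj_leaf:
  assumes "w \<in> V" "deg A w = 1"
  shows "(w, v) \<in> A"
proof (rule ccontr)
  assume nadj: "(w, v) \<notin> A"
  obtain u where u: "A `` {w} = {u}" using assms by (auto simp: deg_def card_1_singleton_iff)
  then have wu: "(w, u) \<in> A" by auto
  then have neq: "u \<noteq> v" "w \<noteq> u" using nadj irrefl_A by (auto simp: irrefl_def)
  have wv: "w \<noteq> v" using assms deg_max_ge_2 by auto
  have uV: "u \<in> V" using wu A_sub by auto
  have u1: "deg A u \<noteq> 1" using leaf_neighbour_deg[OF graph wu] assms card_V by simp
  have vu: "(v, u) \<in> A" using max_adj_inner[OF uV neq(1) u1] .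
  note conn = conn_graph_move_leaf[OF wu assms(2) wv neq(1)]
  show False
  proof (cases "deg A u = 2")
    case False
    \<comment> \<open>With degree at least 3, \<open>u\<close> keeps degree at least 2 when
      \<open>w\<close> is moved and does not become a leaf.\<close>
    then have u3: "3 \<le> deg A u" using deg_ge_2[OF uV u1] by simp
    have "irregularity A < irregularity (add_edge w v (del_edge w u A))"
      by (intro irregularity_move_edge_max fin_A sym_A irrefl_A deg_le_max) fact+
    moreover have "irregularity (add_edge w v (del_edge w u A)) \<le> irregularity A"
      using deg_move_edge[OF fin_A sym_A wu nadj neq(2) wv] u3 deg_max_ge_2 neq
      by (intro not_improvable conn) auto
    ultimately show False by simp
  next
    case True
    obtain x where x: "x \<in> V" "deg A x \<noteq> 1" "x \<noteq> u" "x \<noteq> v" using inner_avoiding by metis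
    have xw: "x \<noteq> w" using x assms by auto
    \<comment> \<open>The two neighbours of \<open>u\<close> are thus \<open>w\<close> and
      \<open>v\<close>, so \<open>u\<close> can be joined to the further non-pendent vertex
      \<open>x\<close>.\<close>
    have "{w, v} \<subseteq> A `` {u}" using wu vu by (auto dest: arc_sym)
    then have "A `` {u} = {w, v}"
      using True wv fin_nbrs by (intro card_subset_eq[symmetric]) (auto simp: deg_def)
    then have ux: "(u, x) \<notin> A" using x xw by auto
    let ?A' = "add_edge u x (add_edge w v (del_edge w u A))"
    have "irregularity A < irregularity ?A'"
      using x xw neq deg_ge_2[OF x(1,2)]
      by (intro irregularity_move_edge_add_edge fin_A sym_A irrefl_A deg_le_max wu wv nadj ux assms True)
        auto
    moreover have "irregularity ?A' \<le> irregularity A"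
    proof (rule not_improvable)
      show "conn_graph V ?A'" using conn_graph_add_edge[OF conn uV x(1)] x by simp
      have "deg ?A' = (deg A)(v := Suc (deg A v), x := Suc (deg A x))"
        using x xw neq wv by (intro deg_move_edge_add_edge fin_A sym_A wu nadj ux) auto
      then show "deg ?A' z = 1 \<longleftrightarrow> deg A z = 1" for z
        using deg_max_ge_2 deg_ge_2[OF x(1,2)] by auto
    qed
    ultimately show False by simp
  qed
qed

lemma max_adj_all:
  assumes "z \<in> V" "z \<noteq> v"
  shows "(v, z) \<in> A"
  using max_adj_inner[OF assms] max_adj_leaf[OF assms(1)] arc_sym by blast

lemma deg_max: "deg A v = card V - 1"
proof -
  have "A `` {v} = V - {v}" using max_adj_all A_sub irrefl_A by (auto simp: irrefl_def)
  then show ?thesis using v fin_V by (simp add: deg_def)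
qed

section \<open>Degrees of the other vertices\<close>

lemma inner_nbrs:
  assumes "z \<noteq> v"
  shows "A `` {z} - {v} \<subseteq> V - leaves V A - {z} - {v}"
proof -
  \<comment> \<open>The only neighbour of a leaf is \<open>v\<close>.\<close>
  have "(z, w) \<notin> A" if "w \<in> V" "deg A w = 1" for w
    using Image_singleton_of_deg_1[OF that(2) max_adj_leaf[OF that]] assms by (auto dest: arc_sym)
  then show ?thesis using A_sub irrefl_A by (auto simp: leaves_def irrefl_def)
qed

text \<open>A non-pendent \<open>z\<close> has only non-pendent neighbours, \<open>v\<close> among
  them; there are \<open>card V - k\<close> non-pendent vertices, one of which is \<open>z\<close>
  itself. For a leaf the bound follows from \<open>k + 3 \<le> card V\<close>.\<close>

lemma deg_nonmax_le:
  assumes "z \<noteq> v"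
  shows "deg A z \<le> card V - k - 1"
proof (cases "z \<in> V \<and> deg A z \<noteq> 1")
  case True
  have "A `` {z} \<subseteq> V - leaves V A - {z}"
    using inner_nbrs[OF assms] v deg_max_ge_2 assms by (auto simp: leaves_def)
  then have "deg A z \<le> card (V - leaves V A - {z})"
    unfolding deg_def using fin_V by (intro card_mono) auto
  also have "\<dots> = card (V - leaves V A) - 1" using True by (simp add: leaves_def)
  also have "\<dots> = card V - k - 1"
    using card_leaves fin_V by (subst card_Diff_subset) (auto simp: leaves_def)
  finally show ?thesis .
next
  case False
  then show ?thesis using deg_outside[of z] card_V by auto
qed

lemma deg_lt_max:
  assumes "1 \<le> k" "z \<noteq> v"
  shows "deg A z < deg A v"
  using deg_nonmax_le[OF assms(2)] deg_max assms(1) card_V by simp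

text \<open>Extremality rules out a strict gain, hence \<open>deg A x < 3\<close>; as adding the
  edge does not decrease the irregularity either, the new graph is extremal again.\<close>

lemma add_edge_second:
  assumes "1 \<le> k" and x: "x \<in> V" "x \<noteq> v" and max2: "\<And>z. z \<noteq> v \<Longrightarrow> deg A z \<le> deg A x"
    and y: "y \<in> V" "y \<noteq> x" "deg A y \<noteq> 1" "(x, y) \<notin> A"
  shows "deg A x = 2" "extremal_graph V (add_edge x y A) k"
proof -
  let ?A' = "add_edge x y A"
  have adj: "(v, x) \<in> A" "(v, y) \<in> A" and yv: "y \<noteq> v"
    using max_adj_all x y by (auto dest: arc_sym)
  have x2: "2 \<le> deg A x" using deg_ge_2[OF y(1,3)] max2[OF yv] by simp
  have conn: "conn_graph V ?A'" using graph x y by (intro conn_graph_add_edge) auto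
  have leaf: "deg ?A' z = 1 \<longleftrightarrow> deg A z = 1" for z
    using deg_add_edge[OF fin_A sym_A y(4)] y x2 deg_ge_2[OF y(1,3)] by auto
  have le: "irregularity ?A' \<le> irregularity A" by (intro not_improvable conn leaf)
  note second = irregularity_add_edge_second[OF fin_A sym_A irrefl_A y(2)[symmetric]
    x(2)[symmetric] yv[symmetric] y(4) adj max2 deg_lt_max[OF assms(1) x(2)] x2]
  show "deg A x = 2" using second(2) le x2 by force
  have "leaves V ?A' = leaves V A" using leaf by (simp add: leaves_def)
  then show "extremal_graph V ?A' k"
    using conn card_leaves card_V extremal second(1)
    by unfold_locales (auto intro: order_trans)
qed

end

end

lemma (in extremal_graph) second_max_deg:
  assumes k: "1 \<le> k" and v: "v \<in> V" and max: "\<And>z. z \<in> V \<Longrightarrow> deg A z \<le> deg A v"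
    and x: "x \<in> V" "x \<noteq> v" and max2: "\<And>z. z \<noteq> v \<Longrightarrow> deg A z \<le> deg A x"
  shows "deg A x = card V - k - 1"
proof -
  have "(x, y) \<in> A" if y: "y \<in> V" "y \<noteq> x" "deg A y \<noteq> 1" for y
  proof (rule ccontr)
    assume xy: "(x, y) \<notin> A"
    let ?A' = "add_edge x y A"
    note second = add_edge_second[OF v max k x max2 y xy]
    \<comment> \<open>All facts about extremal graphs are now available a second time, for the graph
      with the edge \<open>xy\<close>.\<close>
    interpret A': extremal_graph V ?A' k by (rule second(2)) auto
    have d': "deg ?A' = (deg A)(x := 3, y := Suc (deg A y))"
      using deg_add_edge[OF fin_A sym_A xy] y second(1) by auto
    have adj: "(v, z) \<in> A" "(z, v) \<in> A" if "z \<in> V" "z \<noteq> v" for z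
      using max_adj_all[OF v max that] by (auto dest: arc_sym)
    have yv: "y \<noteq> v" using adj[OF x] xy by auto
    then have y2: "deg A y = 2" using max2[of y] second(1) deg_ge_2[OF y(1,3)] by simp
    have other: "\<exists>z'. A `` {z} = {v, z'} \<and> z' \<noteq> v" if z: "z \<in> V" "z \<noteq> v" "deg A z = 2" for z
    proof -
      have "v \<in> A `` {z}" using adj z by auto
      moreover obtain a b where "A `` {z} = {a, b}" "a \<noteq> b"
        using z(3) unfolding deg_def card_2_iff by auto
      ultimately show ?thesis by (auto simp: insert_commute)
    qed
    obtain x' where x': "A `` {x} = {v, x'}" "x' \<noteq> v" using other x second(1) by blast
    obtain y' where y': "A `` {y} = {v, y'}" "y' \<noteq> v" using other y(1) yv y2 by blast
    have arcs: "(x, x') \<in> A" "(y, y') \<in> A" using x' y' by auto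
    then have y'V: "y' \<in> V" and neq: "y' \<noteq> x" "y' \<noteq> y"
      using A_sub irrefl_A xy by (auto simp: irrefl_def dest: arc_sym)
    \<comment> \<open>A common partner would be adjacent to \<open>v\<close>, \<open>x\<close> and
      \<open>y\<close>, but vertices other than \<open>v\<close> have degree at most 2.\<close>
    have "y' \<noteq> x'"
    proof
      assume "y' = x'"
      then have "{v, x, y} \<subseteq> A `` {y'}" using arcs adj y'V y' by (auto dest: arc_sym)
      then have "card {v, x, y} \<le> deg A y'" unfolding deg_def by (intro card_mono fin_nbrs)
      then show False using max2[of y'] y' second(1) x yv y by simp
    qed
    have "deg A y' \<noteq> 1"
    proof
      assume "deg A y' = 1"
      then have "A `` {y'} = {v}" using Image_singleton_of_deg_1 adj y'V y' by metis
      then show False using arcs yv by (auto dest: arc_sym)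
    qed
    \<comment> \<open>In the new graph \<open>v\<close> and \<open>x\<close> still have the largest
      and the second largest degree, and \<open>y'\<close> is a non-pendent vertex not adjacent to
      \<open>x\<close>. This forces degree 2 on \<open>x\<close>, whose degree is now 3.\<close>
    have "deg ?A' x = 2"
    proof (rule A'.add_edge_second(1)[OF v _ k x])
      show "deg ?A' z \<le> deg ?A' v" if "z \<in> V" for z
        using max[OF that] deg_lt_max[OF v max k x(2)] deg_lt_max[OF v max k yv] second(1) y2
          x yv by (auto simp: d')
      show "deg ?A' z \<le> deg ?A' x" if "z \<noteq> v" for z
        using max2[OF that] second(1) y2 by (auto simp: d')
      show "y' \<in> V" "y' \<noteq> x" "deg ?A' y' \<noteq> 1"
        using y'V neq \<open>deg A y' \<noteq> 1\<close> by (auto simp: d')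
      show "(x, y') \<notin> ?A'"
      proof
        assume "(x, y') \<in> ?A'"
        then have "y' \<in> A `` {x}" using neq by (auto simp: add_edge_def)
        then show False using x' y' \<open>y' \<noteq> x'\<close> by simp
      qed
    qed
    then show False using y by (simp add: d')
  qed
  \<comment> \<open>Adjacency to all other non-pendent vertices gives the lower bound that matches
    \<open>deg_nonmax_le\<close>.\<close>
  then have "V - leaves V A - {x} \<subseteq> A `` {x}" by (auto simp: leaves_def)
  then have "card (V - leaves V A - {x}) \<le> deg A x"
    unfolding deg_def by (intro card_mono fin_nbrs)
  moreover have "deg A x \<noteq> 1"
  proof -
    obtain z where "z \<in> V" "deg A z \<noteq> 1" "z \<noteq> v" using inner_avoiding by metis
    then show ?thesis using deg_ge_2[of z] max2[of z] by simp
  qed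
  then have "card (V - leaves V A - {x}) = card (V - leaves V A) - 1"
    using x by (simp add: leaves_def)
  moreover have "card (V - leaves V A) = card V - k"
    using card_leaves fin_V by (subst card_Diff_subset) (auto simp: leaves_def)
  ultimately show ?thesis using deg_nonmax_le[OF v max x(2)] by simp
qed


subsection \<open>Pair graphs\<close>

lemma vdegree_eq_deg: "vdegree G u = deg (parcs G) u"
proof -
  have "bij_betw snd {e \<in> parcs G. fst e = u} (parcs G `` {u})"
    by (rule bij_betwI[of _ _ _ "Pair u"]) auto
  then show ?thesis
    by (simp add: vdegree_def out_degree_def out_arcs_def deg_def bij_betw_same_card)
qed

text \<open>One factor 2 comes from the two arcs of each edge, the other from the 1/2 in
  \<open>SO1\<close>.\<close>

lemma SO1_eq_irregularity:
  assumes "finite (parcs G)" "sym (parcs G)" "irrefl (parcs G)"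
  shows "SO1 G = irregularity (parcs G) / 4"
proof -
  let ?A = "parcs G" and ?h = "\<lambda>e. {fst e, snd e}"
  let ?f = "\<lambda>e. sqdiff (deg ?A) (fst e) (snd e)"
  have edges: "edges G = ?h ` ?A" by (force simp: edges_def)
  have "irregularity ?A = (\<Sum>e\<in>?A. ?f e)"
    by (simp add: irregularity_def arc_sum_def case_prod_unfold)
  \<comment> \<open>Arcs are grouped by their underlying edge; each group consists of an arc and its
    reverse.\<close>
  also have "\<dots> = (\<Sum>E\<in>edges G. \<Sum>e\<in>{e \<in> ?A. ?h e = E}. ?f e)"
    unfolding edges by (rule sum.image_gen[OF assms(1)])
  also have "\<dots> = (\<Sum>E\<in>edges G. 2 * edge_weight G E)"
  proof (rule sum.cong[OF refl])
    fix E assume "E \<in> edges G"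
    then obtain u v where E: "E = {u, v}" and uv: "(u, v) \<in> ?A" by (auto simp: edges_def)
    then have "u \<noteq> v" using assms(3) by (auto simp: irrefl_def)
    moreover have "{e \<in> ?A. ?h e = E} = {(u, v), (v, u)}"
      using uv assms(2) unfolding E by (auto simp: doubleton_eq_iff dest: symD)
    ultimately show "(\<Sum>e\<in>{e \<in> ?A. ?h e = E}. ?f e) = 2 * edge_weight G E"
      by (simp add: E edge_weight_doubleton vdegree_eq_deg sqdiff_commute[of _ v u])
        (simp add: sqdiff_def)
  qed
  finally show ?thesis by (simp add: SO1_def flip: sum_distrib_left)
qed

lemma connected_graphs_iff:
  "G \<in> connected_graphs n k \<longleftrightarrow> conn_graph (pverts G) (parcs G) \<and>
    card (pverts G) = n \<and> card (leaves (pverts G) (parcs G)) = k"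
proof -
  have pend: "pendent G = leaves (pverts G) (parcs G)"
    by (simp add: pendent_def leaves_def vdegree_eq_deg)
  have "pair_graph G \<and> connected (with_proj G) \<longleftrightarrow> conn_graph (pverts G) (parcs G)"
  proof (cases "pair_graph G")
    case True
    then interpret pair_graph G .
    \<comment> \<open>Connectedness is defined through the symmetric closure, which leaves a
      symmetric graph unchanged.\<close>
    have mk: "pverts (mk_symmetric (with_proj G)) = pverts G"
      "parcs (mk_symmetric (with_proj G)) = parcs G"
      using adj_mk_symmetric_eq sym_arcs by auto
    have sub: "parcs G \<subseteq> pverts G \<times> pverts G" by (auto dest: wellformed')
    have "(u, v) \<in> rtrancl_on (pverts G) (parcs G) \<longleftrightarrow> (u, v) \<in> (parcs G)\<^sup>*"
      if "u \<in> pverts G" for u v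
    proof
      assume "(u, v) \<in> (parcs G)\<^sup>*"
      then show "(u, v) \<in> rtrancl_on (pverts G) (parcs G)"
        by (induction rule: rtrancl_induct)
          (use that sub in \<open>auto intro: rtrancl_on_into_rtrancl_on\<close>)
    qed (rule rtrancl_on_rtranclI)
    moreover have "irrefl (parcs G)" using no_loops' by (auto simp: irrefl_def)
    moreover have "sym (parcs G)" using sym_arcs by (simp add: symmetric_def)
    ultimately show ?thesis
      using True sub pair_finite_verts
      by (auto simp: connected_def strongly_connected_def reachable_def mk conn_graph_def)
  next
    case False
    have "pair_graph G" if c: "conn_graph (pverts G) (parcs G)"
    proof
      show "symmetric (with_proj G)" using c by (simp add: symmetric_def conn_graph_def)
    qed (use c conn_graph_finite[OF c] in \<open>auto simp: conn_graph_def irrefl_def\<close>)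
    then show ?thesis using False by blast
  qed
  then show ?thesis by (auto simp: connected_graphs_def pend)
qed

text \<open>With \<open>v\<close> and \<open>x\<close> split off, all remaining degrees are at most
  that of \<open>x\<close>. The increasing list therefore ends with the degrees of \<open>x\<close>
  and \<open>v\<close>, which reversal puts at indices 1 and 0.\<close>

lemma degree_sequence_nth_1:
  assumes "finite (pverts G)" "v \<in> pverts G" "x \<in> pverts G" "x \<noteq> v"
    and "vdegree G x \<le> vdegree G v"
    and max2: "\<And>z. z \<in> pverts G \<Longrightarrow> z \<noteq> v \<Longrightarrow> vdegree G z \<le> vdegree G x"
  shows "degree_sequence G ! 1 = vdegree G x"
proof -
  let ?d = "vdegree G" and ?R = "pverts G - {v, x}"
  define M where "M = image_mset ?d (mset_set ?R)"
  have "pverts G = insert v (insert x ?R)" using assms by auto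
  then have "mset_set (pverts G) = {#v#} + {#x#} + mset_set ?R"
    using assms by (metis (no_types, lifting) Diff_iff add_mset_add_single finite_Diff
        finite_insert insertCI insertE mset_set.insert union_commute union_mset_add_mset_left)
  then have M: "image_mset ?d (mset_set (pverts G)) = {#?d v#} + {#?d x#} + M"
    by (simp add: M_def)
  have "m \<le> ?d x" if "m \<in># M" for m
    using that max2 assms(1) by (auto simp: M_def)
  then have "sorted (sorted_list_of_multiset M @ [?d x, ?d v])"
    using assms(5) by (force simp: sorted_append sorted_sorted_list_of_multiset)
  then have "sort (sorted_list_of_multiset M @ [?d x, ?d v]) = sorted_list_of_multiset M @ [?d x, ?d v]"
    by (rule sorted_sort_id)
  moreover have "image_mset ?d (mset_set (pverts G)) = mset (sorted_list_of_multiset M @ [?d x, ?d v])"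
    using M by simp
  then have "sorted_list_of_multiset (image_mset ?d (mset_set (pverts G)))
      = sort (sorted_list_of_multiset M @ [?d x, ?d v])"
    by (metis sorted_list_of_multiset_mset)
  ultimately show ?thesis by (simp add: degree_sequence_def)
qed

theorem theorem7p9:
  fixes G :: "'a pair_pre_digraph" and n k :: nat
  assumes "1 \<le> k" and "k + 3 \<le> n"
    and "G \<in> connected_graphs n k"
    and "\<And>H :: 'a pair_pre_digraph. H \<in> connected_graphs n k \<Longrightarrow> SO1 H \<le> SO1 G"
  shows "max_degree G = n - 1 \<and> second_max_degree G = n - k - 1 \<and>
    (\<exists>!v. v \<in> pverts G \<and> vdegree G v = n - 1)"
proof -
  let ?V = "pverts G" and ?A = "parcs G"
  have conn: "conn_graph ?V ?A" and n: "card ?V = n" and leaves: "card (leaves ?V ?A) = k"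
    using assms(3) by (auto simp: connected_graphs_iff)
  have SO1: "SO1 H = irregularity (parcs H) / 4" if "conn_graph (pverts H) (parcs H)"
    for H :: "'a pair_pre_digraph"
    using that conn_graph_finite[OF that] by (intro SO1_eq_irregularity) (auto simp: conn_graph_def)
  \<comment> \<open>An arc set \<open>A'\<close> on the vertices of \<open>G\<close> is itself a
    competing pair graph, and the factor 4 cancels in the comparison.\<close>
  interpret extremal_graph ?V ?A k
  proof
    fix A' assume A': "conn_graph ?V A'" "card (leaves ?V A') = k"
    let ?H = "\<lparr>pverts = ?V, parcs = A'\<rparr>"
    have "SO1 ?H \<le> SO1 G" using A' n by (intro assms(4)) (simp add: connected_graphs_iff)
    then show "irregularity A' \<le> irregularity ?A" using SO1[OF conn] SO1[of ?H] A'(1) by simp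
  qed (use conn leaves n assms(2) in auto)
  have "Max (deg ?A ` ?V) \<in> deg ?A ` ?V"
    using conn by (intro Max_in) (auto simp: conn_graph_def)
  then obtain v where v: "v \<in> ?V" "deg ?A v = Max (deg ?A ` ?V)" by auto
  then have max: "deg ?A z \<le> deg ?A v" if "z \<in> ?V" for z using fin_V that by simp
  have "?V - {v} \<noteq> {}" using inner_avoiding by blast
  then have "Max (deg ?A ` (?V - {v})) \<in> deg ?A ` (?V - {v})"
    using fin_V by (intro Max_in) auto
  then obtain x where x: "x \<in> ?V" "x \<noteq> v" "deg ?A x = Max (deg ?A ` (?V - {v}))"
    by (elim imageE) auto
  \<comment> \<open>Elements outside the vertex set have degree 0, so the bound extends to
    them.\<close>
  then have max2: "deg ?A z \<le> deg ?A x" if "z \<noteq> v" for z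
    using fin_V that deg_outside[of z] by (cases "z \<in> ?V") auto
  have "max_degree G = n - 1"
    using deg_max[OF v(1) max] n v(2) by (simp add: max_degree_def vdegree_eq_deg)
  moreover have "second_max_degree G = n - k - 1"
    using degree_sequence_nth_1[OF fin_V v(1) x(1,2)] second_max_deg[OF assms(1) v(1) max x(1,2) max2]
      max[OF x(1)] max2 n by (simp add: second_max_degree_def vdegree_eq_deg)
  moreover have "\<exists>!v. v \<in> ?V \<and> vdegree G v = n - 1"
    using deg_max[OF v(1) max] deg_lt_max[OF v(1) max assms(1)] v(1) n
    by (metis less_irrefl vdegree_eq_deg)
  ultimately show ?thesis by blast
qed

end
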